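(* Let $V:\mathbb{R}^n\to\mathbb{R}$ be the value function $$V(\boldsymbol{x}_0)=\sup_{\pi\in\Pi}\ \sup_{l\in\mathbb{N}}\ \max_{j\in\{1,\ldots,n_0\}} h_{0,j}\big(\boldsymbol{x}^{\pi}_{\boldsymbol{x}_0}(l)\big),$$ and let $\mathcal{R}_0$ be the maximal robust nontermination set of the program. Then $$\mathcal{R}_0=\{\boldsymbol{x}_0\in\mathbb{R}^n\mid V(\boldsymbol{x}_0)\le 0\}.$$
   Context: $\mathbb{N}$ denotes the nonnegative integers. The program under consideration is a single loop: starting from $\boldsymbol{x}:=\boldsymbol{x}_0$, while $\boldsymbol{x}\in X_0$ it executes $\boldsymbol{x}:=\boldsymbol{f}_i(\boldsymbol{x},\boldsymbol{d})$ for the unique $i\in\{1,\ldots,k\}$ with $\boldsymbol{x}\in X_i$, where $\boldsymbol{d}\in D$ is chosen nondeterministically at each iteration. Data: $D=\{\boldsymbol{d}\in\mathbb{R}^m\mid \bigwedge_{i=1}^{n_{k+1}} h_{k+1,i}(\boldsymbol{d})\le 0\}$ is compact with each $h_{k+1,i}:\mathbb{R}^m\to\mathbb{R}$ continuous; $X_0=\{\boldsymbol{x}\in\mathbb{R}^n\mid \bigwedge_{i=1}^{n_0} h_{0,i}(\boldsymbol{x})\le 0\}$ is compact; for $j=1,\ldots,k$, $X_j=\{\boldsymbol{x}\in\mathbb{R}^n\mid \bigwedge_{i=1}^{n_j} h_{j,i}(\boldsymbol{x})\rhd 0\}$, where each $\rhd$ is $\le$ or $<$; all $h_{j,i}:\mathbb{R}^n\to\mathbb{R}$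 ($j=0,\ldots,k$) are continuous; $\boldsymbol{f}_i:\mathbb{R}^n\times D\to\mathbb{R}^n$ ($i=1,\ldots,k$) are continuous. The sets $X_1,\ldots,X_k$ are pairwise disjoint with union $\mathbb{R}^n$. Define $\boldsymbol{f}:\mathbb{R}^n\times D\to\mathbb{R}^n$ by $\boldsymbol{f}(\boldsymbol{x},\boldsymbol{d})=\boldsymbol{f}_i(\boldsymbol{x},\boldsymbol{d})$ when $\boldsymbol{x}\in X_i$. Input policies: $\Pi$ is the set of all maps $\boldsymbol{\pi}:\mathbb{N}\to D$. For $\boldsymbol{x}_0\in\mathbb{R}^n$ and $\pi\in\Pi$, the trajectory $\boldsymbol{x}^{\pi}_{\boldsymbol{x}_0}:\mathbb{N}\to\mathbb{R}^n$ is defined by $\boldsymbol{x}^{\pi}_{\boldsymbol{x}_0}(0)=\boldsymbol{x}_0$ and $\boldsymbol{x}^{\pi}_{\boldsymbol{x}_0}(l+1)=\boldsymbol{f}(\boldsymbol{x}^{\pi}_{\boldsymbol{x}_0}(l),\boldsymbol{\pi}(l))$. The program is robustly non-terminating w.r.t. $\boldsymbol{x}_0$ if $\boldsymbol{x}^{\pi}_{\boldsymbol{x}_0}(l)\in X_0$ for all $\pi\in\Pi$ and all $l\in\mathbb{N}$. The maximal robust nontermination set $\mathcal{R}_0$ is the set of all $\boldsymbol{x}_0\in\mathbb{R}^n$ w.r.t. which the program is robustly non-terminating. Standing convention: $V$ is real-valued, i.e. the supremum defining $V(\boldsymbol{x}_0)$ is finite for every $\boldsymbol{x}_0\in\mathbb{R}^n$.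 *)

theory Defs
  imports "HOL-Analysis.Analysis"
begin

text \<open>
  The constraint functions of the state sets \<open>X\<^sub>0, X\<^sub>1, \<dots>, X\<^sub>k\<close> are \<open>state_con P j i\<close>, for
  \<open>j \<in> {0..k}\<close> and \<open>i \<in> {1..n\<^sub>j}\<close>, and those of the input set \<open>D\<close> are \<open>input_con P i\<close>, for
  \<open>i \<in> {1..n\<^sub>k\<^sub>+\<^sub>1}\<close>.  The flag \<open>is_strict P j i\<close> selects the relation \<open><\<close> (true) or \<open>\<le>\<close> (false)
  of the \<open>i\<close>-th constraint of \<open>X\<^sub>j\<close>; it is only consulted for \<open>j \<ge> 1\<close>.
  Values at indices outside these ranges, and of \<open>branch_map P i\<close> outside \<open>UNIV \<times> D\<close>, are irrelevant.
\<close>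

record ('n::finite, 'm::finite) loop_program =
  num_branches :: nat
  num_state_cons :: "nat \<Rightarrow> nat"
  state_con :: "nat \<Rightarrow> nat \<Rightarrow> real ^ 'n \<Rightarrow> real"
  is_strict :: "nat \<Rightarrow> nat \<Rightarrow> bool"
  num_input_cons :: nat
  input_con :: "nat \<Rightarrow> real ^ 'm \<Rightarrow> real"
  branch_map :: "nat \<Rightarrow> (real ^ 'n) \<times> (real ^ 'm) \<Rightarrow> real ^ 'n"

definition input_set :: "('n::finite, 'm::finite) loop_program \<Rightarrow> (real ^ 'm) set" where
  "input_set P = {d. \<forall>i \<in> {1..num_input_cons P}. input_con P i d \<le> 0}"

definition loop_set :: "('n::finite, 'm::finite) loop_program \<Rightarrow> (real ^ 'n) set" where
  "loop_set P = {x. \<forall>i \<in> {1..num_state_cons P 0}. state_con P 0 i x \<le> 0}"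

definition branch_set :: "('n::finite, 'm::finite) loop_program \<Rightarrow> nat \<Rightarrow> (real ^ 'n) set" where
  "branch_set P j =
     {x. \<forall>i \<in> {1..num_state_cons P j}.
           if is_strict P j i then state_con P j i x < 0 else state_con P j i x \<le> 0}"

text \<open>
  Nonemptiness of \<open>{1..k}\<close> and of \<open>{1..n\<^sub>0}\<close> is not listed: the branch sets cover the nonempty state
  space, and \<open>n\<^sub>0 = 0\<close> would make \<open>X\<^sub>0\<close> the whole space, which is not compact.
\<close>

definition wf_program :: "('n::finite, 'm::finite) loop_program \<Rightarrow> bool" where
  "wf_program P \<longleftrightarrow>
     compact (input_set P) \<and>
     (\<forall>i \<in> {1..num_input_cons P}. continuous_on UNIV (input_con P i)) \<and>
     compact (loop_set P) \<and>
     (\<forall>j \<in> {0..num_branches P}. \<forall>i \<in> {1..num_state_cons P j}.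
        continuous_on UNIV (state_con P j i)) \<and>
     (\<forall>i \<in> {1..num_branches P}. continuous_on (UNIV \<times> input_set P) (branch_map P i)) \<and>
     disjoint_family_on (branch_set P) {1..num_branches P} \<and>
     (\<Union>j \<in> {1..num_branches P}. branch_set P j) = UNIV"

definition step :: "('n::finite, 'm::finite) loop_program \<Rightarrow> real ^ 'n \<Rightarrow> real ^ 'm \<Rightarrow> real ^ 'n" where
  "step P x d = branch_map P (THE i. i \<in> {1..num_branches P} \<and> x \<in> branch_set P i) (x, d)"

definition policies :: "('n::finite, 'm::finite) loop_program \<Rightarrow> (nat \<Rightarrow> real ^ 'm) set" where
  "policies P = {\<pi>. \<forall>l. \<pi> l \<in> input_set P}"

primrec trajectory ::
  "('n::finite, 'm::finite) loop_program \<Rightarrow> (nat \<Rightarrow> real ^ 'm) \<Rightarrow> real ^ 'n \<Rightarrow> nat \<Rightarrow> real ^ 'n" where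
  "trajectory P \<pi> x0 0 = x0"
| "trajectory P \<pi> x0 (Suc l) = step P (trajectory P \<pi> x0 l) (\<pi> l)"

definition robustly_nonterminating :: "('n::finite, 'm::finite) loop_program \<Rightarrow> real ^ 'n \<Rightarrow> bool" where
  "robustly_nonterminating P x0 \<longleftrightarrow>
     (\<forall>\<pi> \<in> policies P. \<forall>l. trajectory P \<pi> x0 l \<in> loop_set P)"

definition max_robust_nontermination_set :: "('n::finite, 'm::finite) loop_program \<Rightarrow> (real ^ 'n) set" where
  "max_robust_nontermination_set P = {x0. robustly_nonterminating P x0}"

text \<open>
  The suprema are taken in the extended reals, so that an unbounded supremum is \<open>\<infinity>\<close> and a supremum
  over an empty set of policies is \<open>-\<infinity>\<close>, rather than an unspecified real number.
\<close>

definition ext_value :: "('n::finite, 'm::finite) loop_program \<Rightarrow> real ^ 'n \<Rightarrow> ereal" where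
  "ext_value P x0 =
     (SUP \<pi> \<in> policies P. SUP l.
        ereal (Max ((\<lambda>j. state_con P 0 j (trajectory P \<pi> x0 l)) ` {1..num_state_cons P 0})))"

text \<open>\<open>V\<close> is the value function, and all the suprema defining it are finite.\<close>

definition is_value_function :: "('n::finite, 'm::finite) loop_program \<Rightarrow> (real ^ 'n \<Rightarrow> real) \<Rightarrow> bool" where
  "is_value_function P V \<longleftrightarrow> (\<forall>x0. ereal (V x0) = ext_value P x0)"

end

theory Submission
  imports Defs
begin

text \<open>A supremum is at most 0 iff each of its terms is, and a finite maximum is at most 0 iff
  each entry is. So \<open>V x0 \<le> 0\<close> says that every state on every trajectory satisfies
  all constraints of \<open>loop_set P\<close> (\<open>ext_value_le_0_iff\<close>). Compactness of
  \<open>loop_set P\<close> ensures that the maximum ranges over a nonempty set.\<close>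

lemma num_loop_cons_pos:
  fixes P :: "('n::finite, 'm::finite) loop_program"
  assumes "wf_program P"
  shows "0 < num_state_cons P 0"
proof (rule ccontr)
  assume "\<not> 0 < num_state_cons P 0"
  \<comment> \<open>Without constraints the defining conjunction is vacuous.\<close>
  then have "loop_set P = UNIV"
    by (simp add: loop_set_def)
  moreover have "bounded (loop_set P)"
    using assms by (simp add: wf_program_def compact_imp_bounded)
  ultimately show False
    using not_bounded_UNIV[where 'a = "real ^ 'n"] by simp
qed

text \<open>Positivity is assumed because \<open>Max\<close> of the empty set is
  unspecified.\<close>

lemma loop_set_iff_Max_le:
  assumes "0 < num_state_cons P 0"
  shows "x \<in> loop_set P \<longleftrightarrow> Max ((\<lambda>j. state_con P 0 j x) ` {1..num_state_cons P 0}) \<le> 0"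
  using assms by (subst Max_le_iff) (auto simp: loop_set_def)

text \<open>In the complete lattice \<open>ereal\<close>, \<open>SUP_le_iff\<close> has no
  boundedness or nonemptiness conditions. If there are no policies, the supremum is
  \<open>-\<infinity>\<close> and the right-hand side holds vacuously.\<close>

lemma ext_value_le_0_iff:
  assumes "0 < num_state_cons P 0"
  shows "ext_value P x0 \<le> 0 \<longleftrightarrow> robustly_nonterminating P x0"
  unfolding ext_value_def robustly_nonterminating_def SUP_le_iff loop_set_iff_Max_le[OF assms]
  by simp

theorem theorem1:
  fixes P :: "('n::finite, 'm::finite) loop_program"
    and V :: "real ^ 'n \<Rightarrow> real"
  assumes "wf_program P"
    and "is_value_function P V"
  shows "max_robust_nontermination_set P = {x0. V x0 \<le> 0}"
proof -
  have "V x0 \<le> 0 \<longleftrightarrow> ext_value P x0 \<le> 0" for x0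
  proof -
    have "ext_value P x0 = ereal (V x0)"
      using assms(2) by (simp add: is_value_function_def)
    then show ?thesis by simp
  qed
  then show ?thesis
    using ext_value_le_0_iff[OF num_loop_cons_pos[OF assms(1)]]
    by (simp add: max_robust_nontermination_set_def)
qed

end
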